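(* Let $m>1$ and let $\mathcal{L}_m$ be a linear transformation $u\mapsto \mathcal{L}_m u=\big(\sum_{j\ge 0}K(n,j)u_j\big)_{n\ge 0}$ given by a kernel $K$ on $(\mathbb{N}\cup\{0\})^2$, which for every $k\in\{1,\dots,m-1\}$ maps every polynomial of degree exactly $k$ to a polynomial of degree exactly $k$. If $K$ is totally positive of order $m+1$ or $-K$ is totally negative of order $m+1$, then $\mathcal{L}_m$ preserves $m$-convexity (resp. $m$-concavity). Conversely, if $-K$ is totally positive of order $m+1$ or $K$ is totally negative of order $m+1$, then $\mathcal{L}_m$ reverses $m$-convexity (resp. $m$-concavity).
   Context: A kernel (infinite matrix) is totally positive of order $r$ ($TP_r$) if all its minors of orders $1,\dots,r$ are nonnegative, and totally negative of order $r$ ($TN_r$) if all its minors of orders $1,\dots,r$ are nonpositive. All sequences are indexed by $\mathbb{N}\cup\{0\}$. A polynomial $P$ is identified with the sequence $(P(j))_{j\ge0}$, so $\mathcal{L}_m P$ is the sequence $n\mapsto\sum_{j\ge0}K(n,j)P(j)$. The series defining $\mathcal{L}_m u$ is assumed to converge (uniformly in $n$). With $\Delta u=(u_{k+1}-u_k)_k$ and $\Delta^m=\Delta^{m-1}\Delta$, a sequence $u$ is $m$-convex if $\Delta^m u\ge0$; in the more general formulation, $u$ is $m$-convex if for every polynomial $p$ of degree $m-1$ the sequence $(u_k-p(k))$ has at most $m$ changes of sign, and if exactly $m$ changes occur they follow the pattern $+-+\cdots$ (the last sign, as the index increases to the right end, being $+$ for convexity in the sense $\Delta^m u\ge 0$).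 A sequence $u$ is $m$-concave if $-u$ is $m$-convex. $\mathcal{L}_m$ preserves $m$-convexity (resp. $m$-concavity) if it maps each $m$-convex (resp. $m$-concave) sequence on which it is defined to an $m$-convex (resp. $m$-concave) sequence; it reverses $m$-convexity (resp. $m$-concavity) if it maps each such $m$-convex (resp. $m$-concave) sequence to an $m$-concave (resp. $m$-convex) sequence. *)

theory Defs
  imports Complex_Main "HOL-Computational_Algebra.Polynomial" "Jordan_Normal_Form.Determinant"
begin

definition minor :: "(nat \<Rightarrow> nat \<Rightarrow> real) \<Rightarrow> nat \<Rightarrow> (nat \<Rightarrow> nat) \<Rightarrow> (nat \<Rightarrow> nat) \<Rightarrow> real" where
  "minor K r \<rho> \<kappa> = det (mat r r (\<lambda>(i, j). K (\<rho> i) (\<kappa> j)))"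

(* The rows \<rho> 0 < ... < \<rho> (s - 1) and columns \<kappa> 0 < ... < \<kappa> (s - 1) of a minor are
   selected by functions of which only the values on {..<s} matter. *)
definition totally_positive :: "nat \<Rightarrow> (nat \<Rightarrow> nat \<Rightarrow> real) \<Rightarrow> bool" where
  "totally_positive r K \<longleftrightarrow>
     (\<forall>s\<in>{1..r}. \<forall>\<rho> \<kappa>. strict_mono_on {..<s} \<rho> \<longrightarrow> strict_mono_on {..<s} \<kappa> \<longrightarrow>
        minor K s \<rho> \<kappa> \<ge> 0)"

definition totally_negative :: "nat \<Rightarrow> (nat \<Rightarrow> nat \<Rightarrow> real) \<Rightarrow> bool" where
  "totally_negative r K \<longleftrightarrow>
     (\<forall>s\<in>{1..r}. \<forall>\<rho> \<kappa>. strict_mono_on {..<s} \<rho> \<longrightarrow> strict_mono_on {..<s} \<kappa> \<longrightarrow>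
        minor K s \<rho> \<kappa> \<le> 0)"

definition fdiff :: "(nat \<Rightarrow> real) \<Rightarrow> nat \<Rightarrow> real" where
  "fdiff u = (\<lambda>k. u (Suc k) - u k)"

definition seq_convex :: "nat \<Rightarrow> (nat \<Rightarrow> real) \<Rightarrow> bool" where
  "seq_convex m u \<longleftrightarrow> (\<forall>k. (fdiff ^^ m) u k \<ge> 0)"

definition seq_concave :: "nat \<Rightarrow> (nat \<Rightarrow> real) \<Rightarrow> bool" where
  "seq_concave m u \<longleftrightarrow> seq_convex m (\<lambda>k. - u k)"

(* Convergence is required for every n, equivalently uniformly on bounded sets of n.
   Uniform convergence over all n is not required: it would already exclude the
   identity kernel applied to the sequence j, whose partial sums vanish for large n.
   Since fewer sequences converge uniformly, a preservation statement about the domain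
   below includes the one about sequences with uniformly convergent series. *)
definition kernel_defined :: "(nat \<Rightarrow> nat \<Rightarrow> real) \<Rightarrow> (nat \<Rightarrow> real) \<Rightarrow> bool" where
  "kernel_defined K u \<longleftrightarrow> (\<forall>n. summable (\<lambda>j. K n j * u j))"

definition kernel_op :: "(nat \<Rightarrow> nat \<Rightarrow> real) \<Rightarrow> (nat \<Rightarrow> real) \<Rightarrow> nat \<Rightarrow> real" where
  "kernel_op K u = (\<lambda>n. \<Sum>j. K n j * u j)"

definition poly_seq :: "real poly \<Rightarrow> nat \<Rightarrow> real" where
  "poly_seq p = (\<lambda>j. poly p (real j))"

definition maps_degree :: "(nat \<Rightarrow> nat \<Rightarrow> real) \<Rightarrow> nat \<Rightarrow> bool" where
  "maps_degree K k \<longleftrightarrow>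
     (\<forall>p. degree p = k \<longrightarrow>
        kernel_defined K (poly_seq p) \<and>
        (\<exists>q. degree q = k \<and> kernel_op K (poly_seq p) = poly_seq q))"

definition preserves_convexity :: "nat \<Rightarrow> (nat \<Rightarrow> nat \<Rightarrow> real) \<Rightarrow> bool" where
  "preserves_convexity m K \<longleftrightarrow>
     (\<forall>u. kernel_defined K u \<longrightarrow> seq_convex m u \<longrightarrow> seq_convex m (kernel_op K u))"

definition preserves_concavity :: "nat \<Rightarrow> (nat \<Rightarrow> nat \<Rightarrow> real) \<Rightarrow> bool" where
  "preserves_concavity m K \<longleftrightarrow>
     (\<forall>u. kernel_defined K u \<longrightarrow> seq_concave m u \<longrightarrow> seq_concave m (kernel_op K u))"

definition reverses_convexity :: "nat \<Rightarrow> (nat \<Rightarrow> nat \<Rightarrow> real) \<Rightarrow> bool" where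
  "reverses_convexity m K \<longleftrightarrow>
     (\<forall>u. kernel_defined K u \<longrightarrow> seq_convex m u \<longrightarrow> seq_concave m (kernel_op K u))"

definition reverses_concavity :: "nat \<Rightarrow> (nat \<Rightarrow> nat \<Rightarrow> real) \<Rightarrow> bool" where
  "reverses_concavity m K \<longleftrightarrow>
     (\<forall>u. kernel_defined K u \<longrightarrow> seq_concave m u \<longrightarrow> seq_convex m (kernel_op K u))"

end

(*
  Evaluate 1, j, ..., j^(m-1), u at m + 1 increasing points. The resulting determinant is
  nonnegative for m-convex u (subtract adjacent rows and induct on m), hence by the Cauchy-Binet
  formula so is the determinant of the images under a totally positive K. At consecutive points
  n, ..., n + m the latter equals c_0 ... c_(m-1) times the m-th difference of the image of u at
  n, where c_i is the nonzero constant i-th difference of the image of j^i; the product of the c_i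
  is positive by the same argument with m - 1 in place of m. The totally negative cases are
  vacuous: order 2 already contradicts degree preservation.
*)

theory Submission imports Defs begin

section \<open>Minors\<close>

lemma minor_eq_sum_permutations:
  "minor M n \<rho> \<kappa> =
     (\<Sum>p | p permutes {0..<n}. signof p * (\<Prod>i = 0..<n. M (\<rho> i) (\<kappa> (p i))))"
proof -
  have "minor M n \<rho> \<kappa> = (\<Sum>p | p permutes {0..<n}.
      signof p * (\<Prod>i = 0..<n. mat n n (\<lambda>(i, j). M (\<rho> i) (\<kappa> j)) $$ (i, p i)))"
    unfolding minor_def by (rule det_def') simp
  also have "\<dots> = (\<Sum>p | p permutes {0..<n}. signof p * (\<Prod>i = 0..<n. M (\<rho> i) (\<kappa> (p i))))"
    by (intro sum.cong refl arg_cong2[of _ _ _ _ "(*)"] prod.cong) (auto dest: permutes_nat_less)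
  finally show ?thesis .
qed

lemma minor_transpose: "minor M n \<rho> \<kappa> = minor (\<lambda>i j. M j i) n \<kappa> \<rho>"
proof -
  have "minor M n \<rho> \<kappa> = det (transpose_mat (mat n n (\<lambda>(i, j). M (\<rho> i) (\<kappa> j))))"
    unfolding minor_def by (rule det_transpose[symmetric]) auto
  also have "transpose_mat (mat n n (\<lambda>(i, j). M (\<rho> i) (\<kappa> j))) = mat n n (\<lambda>(i, j). M (\<rho> j) (\<kappa> i))"
    by (intro eq_matI) auto
  finally show ?thesis
    unfolding minor_def .
qed

lemma minor_permute_rows:
  assumes "\<sigma> permutes {0..<n}"
  shows "minor M n (\<rho> \<circ> \<sigma>) \<kappa> = signof \<sigma> * minor M n \<rho> \<kappa>"
proof -
  let ?A = "mat n n (\<lambda>(i, j). M (\<rho> i) (\<kappa> j))"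
  have "minor M n (\<rho> \<circ> \<sigma>) \<kappa> = det (mat n n (\<lambda>(i, j). ?A $$ (\<sigma> i, j)))"
    unfolding minor_def using assms
    by (intro arg_cong[of _ _ det] cong_mat) (auto dest: permutes_nat_less)
  also have "\<dots> = signof \<sigma> * det ?A"
    using assms by (intro det_permute_rows) auto
  finally show ?thesis
    unfolding minor_def .
qed

lemma minor_permute_columns:
  assumes "\<sigma> permutes {0..<n}"
  shows "minor M n \<rho> (\<kappa> \<circ> \<sigma>) = signof \<sigma> * minor M n \<rho> \<kappa>"
  using minor_permute_rows[OF assms, of "\<lambda>i j. M j i" \<kappa> \<rho>] by (simp only: minor_transpose[of M])

lemma minor_repeated_row:
  assumes "\<not> inj_on \<rho> {0..<n}"
  shows "minor M n \<rho> \<kappa> = 0"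
proof -
  obtain i j where "i < n" "j < n" "i \<noteq> j" "\<rho> i = \<rho> j"
    using assms unfolding inj_on_def by auto
  then show ?thesis
    unfolding minor_def by (intro det_identical_rows[of _ n i j]) auto
qed

lemma minor_uminus: "minor (\<lambda>i j. - M i j) n \<rho> \<kappa> = (- 1) ^ n * minor M n \<rho> \<kappa>"
  by (simp add: minor_eq_sum_permutations prod_uminus sum_distrib_left mult.left_commute)

section \<open>Sorting of index maps and the Cauchy-Binet formula\<close>

text \<open>The sorting permutation is the increasing enumeration \<open>h\<close> of the image
  followed by the inverse of \<open>\<tau>\<close>.\<close>

lemma ex_permutes_strict_mono:
  fixes \<tau> :: "nat \<Rightarrow> nat"
  assumes inj: "inj_on \<tau> {0..<n}"
  obtains \<sigma> where "\<sigma> permutes {0..<n}" "strict_mono_on {..<n} (\<tau> \<circ> \<sigma>)"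
proof -
  have card: "card (\<tau> ` {0..<n}) = n"
    using card_image[OF inj] by simp
  obtain h where bij: "bij_betw h {..<n} (\<tau> ` {0..<n})" and mono: "strict_mono_on {..<n} h"
    using ex_bij_betw_strict_mono_card[of "\<tau> ` {0..<n}"] unfolding card by auto
  define \<sigma> where "\<sigma> = (\<lambda>i. if i \<in> {0..<n} then (the_inv_into {0..<n} \<tau> \<circ> h) i else i)"
  have "bij_betw (the_inv_into {0..<n} \<tau> \<circ> h) {0..<n} {0..<n}"
    using bij_betw_trans[OF bij bij_betw_the_inv_into[OF inj_on_imp_bij_betw[OF inj]]]
    by (simp add: atLeast0LessThan)
  then have "bij_betw \<sigma> {0..<n} {0..<n}"
    by (subst bij_betw_cong[where g = "the_inv_into {0..<n} \<tau> \<circ> h"]) (auto simp: \<sigma>_def)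
  then have "\<sigma> permutes {0..<n}"
    by (rule bij_imp_permutes) (auto simp: \<sigma>_def)
  moreover have "(\<tau> \<circ> \<sigma>) i = h i" if "i < n" for i
    using that bij f_the_inv_into_f[OF inj, of "h i"]
    by (auto simp: \<sigma>_def bij_betw_def)
  then have "strict_mono_on {..<n} (\<tau> \<circ> \<sigma>)"
    using mono by (auto simp: strict_mono_on_def)
  ultimately show thesis
    by (rule that)
qed

text \<open>Multilinearity in the rows: expanding each Leibniz product amounts to choosing one
  summand \<open>\<tau> l\<close> in every row \<open>l\<close>. The index sets depend on the row so
  that they can also be the gaps between sample points.\<close>

lemma det_sum_rows:
  fixes F :: "nat \<Rightarrow> 'b \<Rightarrow> nat \<Rightarrow> 'c :: comm_ring_1"
  assumes fin: "\<And>l. l < n \<Longrightarrow> finite (S l)"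
  shows "det (mat n n (\<lambda>(l, i). \<Sum>t\<in>S l. F l t i)) =
           (\<Sum>\<tau>\<in>PiE {0..<n} S. det (mat n n (\<lambda>(l, i). F l (\<tau> l) i)))"
proof -
  have det: "det (mat n n (\<lambda>(l, i). f l i)) =
      (\<Sum>p | p permutes {0..<n}. signof p * (\<Prod>l = 0..<n. f l (p l)))"
    for f :: "nat \<Rightarrow> nat \<Rightarrow> 'c"
    by (subst det_def'[of _ n], simp)
       (intro sum.cong refl arg_cong2[of _ _ _ _ "(*)"] prod.cong, auto dest: permutes_nat_less)
  have "det (mat n n (\<lambda>(l, i). \<Sum>t\<in>S l. F l t i)) =
      (\<Sum>p | p permutes {0..<n}. signof p * (\<Sum>\<tau>\<in>PiE {0..<n} S. \<Prod>l = 0..<n. F l (\<tau> l) (p l)))"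
    unfolding det using fin by (subst prod_sum_PiE) auto
  also have "\<dots> = (\<Sum>\<tau>\<in>PiE {0..<n} S.
      \<Sum>p | p permutes {0..<n}. signof p * (\<Prod>l = 0..<n. F l (\<tau> l) (p l)))"
    unfolding sum_distrib_left by (rule sum.swap)
  finally show ?thesis
    unfolding det .
qed

text \<open>
  Averaging the row expansion over all permutations gives the Cauchy-Binet formula in the form
  \<open>n! det (A B) = (\<Sum>\<tau>. det A\<^sub>\<tau> det B\<^sub>\<tau>)\<close>, with \<open>\<tau>\<close> ranging over all index
  maps; sorting \<open>\<tau>\<close> changes both factors by the same sign.
\<close>

lemma minor_matrix_product:
  fixes A B :: "nat \<Rightarrow> nat \<Rightarrow> real"
  shows "fact n * minor (\<lambda>i k. \<Sum>j<N. A i j * B j k) n \<rho> \<gamma> =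
           (\<Sum>\<tau>\<in>{0..<n} \<rightarrow>\<^sub>E {..<N}. minor A n \<rho> \<tau> * minor B n \<tau> \<gamma>)"
proof -
  let ?T = "{0..<n} \<rightarrow>\<^sub>E {..<N}" and ?P = "{p. p permutes {0..<n}}"
  have scale: "det (mat n n (\<lambda>(l, k). A (\<rho> l) (\<tau> l) * B (\<tau> l) (\<gamma> k))) =
      (\<Prod>l = 0..<n. A (\<rho> l) (\<tau> l)) * minor B n \<tau> \<gamma>" for \<tau>
  proof -
    have "det (mat n n (\<lambda>(l, k). A (\<rho> l) (\<tau> l) * B (\<tau> l) (\<gamma> k))) =
        minor (\<lambda>l k. A (\<rho> l) (\<tau> l) * B (\<tau> l) (\<gamma> k)) n (\<lambda>l. l) (\<lambda>k. k)"
      unfolding minor_def ..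
    then show ?thesis
      by (simp add: minor_eq_sum_permutations prod.distrib sum_distrib_left mult.left_commute)
  qed
  define D where "D = minor (\<lambda>i k. \<Sum>j<N. A i j * B j k) n \<rho> \<gamma>"
  have expand: "D = (\<Sum>\<tau>\<in>?T. (\<Prod>l = 0..<n. A (\<rho> l) (\<tau> l)) * minor B n \<tau> \<gamma>)"
    unfolding D_def minor_def[of "\<lambda>i k. \<Sum>j<N. A i j * B j k"] scale[symmetric]
    by (rule det_sum_rows) simp
  have permuted: "D = (\<Sum>\<tau>\<in>?T. (\<Prod>l = 0..<n. A (\<rho> l) (\<tau> (\<sigma> l))) * (signof \<sigma> * minor B n \<tau> \<gamma>))"
    if \<sigma>: "\<sigma> permutes {0..<n}" for \<sigma>
  proof -
    \<comment> \<open>A permutation of \<open>{0..<n}\<close> fixes every point outside, so the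
      composite keeps the value \<open>undefined\<close> there.\<close>
    have closed: "\<tau> \<circ> \<pi> \<in> ?T" if "\<pi> permutes {0..<n}" "\<tau> \<in> ?T" for \<tau> \<pi>
      using that permutes_in_image[OF that(1)] permutes_not_in[OF that(1)]
      by (fastforce simp: PiE_def extensional_def Pi_def)
    have "D = (\<Sum>\<tau>\<in>?T. (\<Prod>l = 0..<n. A (\<rho> l) ((\<tau> \<circ> \<sigma>) l)) * minor B n (\<tau> \<circ> \<sigma>) \<gamma>)"
      unfolding expand
      by (rule sum.reindex_bij_witness[of _ "\<lambda>\<tau>. \<tau> \<circ> \<sigma>" "\<lambda>\<tau>. \<tau> \<circ> Hilbert_Choice.inv \<sigma>"])
         (use closed[OF \<sigma>] closed[OF permutes_inv[OF \<sigma>]] permutes_inv_o[OF \<sigma>]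
           in \<open>simp_all add: o_assoc[symmetric]\<close>)
    then show ?thesis
      by (simp add: minor_permute_rows[OF \<sigma>])
  qed
  have "fact n * D = (\<Sum>\<sigma>\<in>?P. D)"
    by (simp add: card_permutations)
  also have "\<dots> = (\<Sum>\<sigma>\<in>?P. \<Sum>\<tau>\<in>?T.
      (\<Prod>l = 0..<n. A (\<rho> l) (\<tau> (\<sigma> l))) * (signof \<sigma> * minor B n \<tau> \<gamma>))"
    by (intro sum.cong refl) (use permuted in auto)
  \<comment> \<open>For fixed \<open>\<tau>\<close>, the sum over \<open>\<sigma>\<close> is the
    Leibniz expansion of \<open>minor A n \<rho> \<tau>\<close>.\<close>
  also have "\<dots> = (\<Sum>\<tau>\<in>?T. minor A n \<rho> \<tau> * minor B n \<tau> \<gamma>)"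
    unfolding minor_eq_sum_permutations[of A] sum_distrib_right
    by (subst sum.swap) (simp add: mult_ac)
  finally show ?thesis
    unfolding D_def .
qed

text \<open>A map \<open>\<tau>\<close> that is not injective makes the second factor vanish;
  sorting an injective one changes both factors by the same sign, which cancels. The factor
  \<open>\<epsilon>\<close> allows one argument to serve both signs of the minors.\<close>

lemma minor_matrix_product_nonneg:
  fixes A B :: "nat \<Rightarrow> nat \<Rightarrow> real"
  assumes "\<And>\<kappa>. strict_mono_on {..<n} \<kappa> \<Longrightarrow> \<epsilon> * (minor A n \<rho> \<kappa> * minor B n \<kappa> \<gamma>) \<ge> 0"
  shows "\<epsilon> * minor (\<lambda>i k. \<Sum>j<N. A i j * B j k) n \<rho> \<gamma> \<ge> 0"
proof -
  have "\<epsilon> * (minor A n \<rho> \<tau> * minor B n \<tau> \<gamma>) \<ge> 0" for \<tau>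
  proof (cases "inj_on \<tau> {0..<n}")
    case True
    then obtain \<sigma> where \<sigma>: "\<sigma> permutes {0..<n}" and mono: "strict_mono_on {..<n} (\<tau> \<circ> \<sigma>)"
      by (rule ex_permutes_strict_mono)
    have "minor A n \<rho> (\<tau> \<circ> \<sigma>) * minor B n (\<tau> \<circ> \<sigma>) \<gamma> = minor A n \<rho> \<tau> * minor B n \<tau> \<gamma>"
      by (simp add: minor_permute_rows[OF \<sigma>] minor_permute_columns[OF \<sigma>] sign_def)
    with assms[OF mono] show ?thesis
      by simp
  qed (simp add: minor_repeated_row)
  then have "\<epsilon> * (fact n * minor (\<lambda>i k. \<Sum>j<N. A i j * B j k) n \<rho> \<gamma>) \<ge> 0"
    unfolding minor_matrix_product sum_distrib_left by (intro sum_nonneg)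
  then have "fact n * (\<epsilon> * minor (\<lambda>i k. \<Sum>j<N. A i j * B j k) n \<rho> \<gamma>) \<ge> 0"
    by (simp only: mult.left_commute)
  then show ?thesis
    using fact_gt_zero[of n, where 'a = real] by (simp only: zero_le_mult_iff[of "fact n"]) linarith
qed

lemma tendsto_minor:
  assumes "\<And>i j. i < n \<Longrightarrow> j < n \<Longrightarrow> ((\<lambda>N. M N (\<rho> i) (\<kappa> j)) \<longlongrightarrow> L (\<rho> i) (\<kappa> j)) F"
  shows "((\<lambda>N. minor (M N) n \<rho> \<kappa>) \<longlongrightarrow> minor L n \<rho> \<kappa>) F"
  unfolding minor_eq_sum_permutations
  by (intro tendsto_sum tendsto_mult tendsto_const tendsto_prod assms) (auto dest: permutes_nat_less)

text \<open>Truncating the series after \<open>N\<close> terms leaves a finite matrix product. The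
  sign survives the limit because a minor is a polynomial in finitely many entries, so convergence
  in each row suffices.\<close>

lemma minor_kernel_op_nonneg:
  assumes defined: "\<And>k. k < n \<Longrightarrow> kernel_defined K (g k)"
    and nonneg: "\<And>\<kappa>. strict_mono_on {..<n} \<kappa> \<Longrightarrow>
      \<epsilon> * (minor K n \<rho> \<kappa> * minor (\<lambda>j k. g k j) n \<kappa> (\<lambda>k. k)) \<ge> 0"
  shows "\<epsilon> * minor (\<lambda>j k. kernel_op K (g k) j) n \<rho> (\<lambda>k. k) \<ge> 0"
proof -
  have "(\<lambda>N. \<epsilon> * minor (\<lambda>i k. \<Sum>j<N. K i j * g k j) n \<rho> (\<lambda>k. k)) \<longlonglongrightarrow>
      \<epsilon> * minor (\<lambda>j k. kernel_op K (g k) j) n \<rho> (\<lambda>k. k)"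
    unfolding kernel_op_def
    by (intro tendsto_mult tendsto_const tendsto_minor summable_LIMSEQ) (use defined in \<open>auto simp: kernel_defined_def\<close>)
  moreover have "\<epsilon> * minor (\<lambda>i k. \<Sum>j<N. K i j * g k j) n \<rho> (\<lambda>k. k) \<ge> 0" for N
    by (rule minor_matrix_product_nonneg) (rule nonneg)
  ultimately show ?thesis
    by (intro LIMSEQ_le_const) auto
qed


section \<open>Collocation determinants\<close>

text \<open>Subtracting from each row its predecessor turns the first column into
  \<open>c, 0, ..., 0\<close>. The row operations are encoded as a factorization
  \<open>E * D\<close>, where \<open>E\<close> is the unit lower triangular matrix of partial sums
  and \<open>D\<close> holds the differences.\<close>

lemma det_const_first_column:
  fixes g :: "nat \<Rightarrow> nat \<Rightarrow> 'a :: idom"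
  assumes const: "\<And>k. g 0 k = c"
  shows "det (mat (Suc n) (Suc n) (\<lambda>(l, i). g i (t l))) =
           c * det (mat n n (\<lambda>(l, i). g (Suc i) (t (Suc l)) - g (Suc i) (t l)))"
proof -
  define E :: "'a mat" where "E = mat (Suc n) (Suc n) (\<lambda>(l, k). if k \<le> l then 1 else 0)"
  define D where "D = mat (Suc n) (Suc n)
    (\<lambda>(l, i). g i (t l) - (if l = 0 then 0 else g i (t (l - 1))))"
  have carrier: "E \<in> carrier_mat (Suc n) (Suc n)" "D \<in> carrier_mat (Suc n) (Suc n)"
    by (simp_all add: E_def D_def)
  \<comment> \<open>Telescoping: partial sums of the rows of \<open>D\<close> recover the original
    rows.\<close>
  have "(\<Sum>k\<le>l. g i (t k) - (if k = 0 then 0 else g i (t (k - 1)))) = g i (t l)" for i l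
    by (induction l) auto
  moreover have "(\<Sum>k = 0..<Suc n. (if k \<le> l then 1 else 0) * f k) = (\<Sum>k\<le>l. f k)"
    if "l < Suc n" for l and f :: "nat \<Rightarrow> 'a"
    using that by (intro sum.mono_neutral_cong_right) auto
  ultimately have "E * D = mat (Suc n) (Suc n) (\<lambda>(l, i). g i (t l))"
    by (intro eq_matI) (auto simp: E_def D_def scalar_prod_def simp del: sum.op_ivl_Suc)
  then have "det (mat (Suc n) (Suc n) (\<lambda>(l, i). g i (t l))) = det E * det D"
    using det_mult[OF carrier] by simp
  moreover have "det E = 1"
    by (subst det_lower_triangular[OF _ carrier(1)])
       (auto simp: E_def prod_list_diag_prod)
  moreover have "D = four_block_mat (mat 1 1 (\<lambda>_. c)) (mat 1 n (\<lambda>(_, i). g (Suc i) (t 0)))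
      (0\<^sub>m n 1) (mat n n (\<lambda>(l, i). g (Suc i) (t (Suc l)) - g (Suc i) (t l)))"
    by (rule eq_matI) (auto simp: D_def const)
  then have "det D = c * det (mat n n (\<lambda>(l, i). g (Suc i) (t (Suc l)) - g (Suc i) (t l)))"
    by (simp add: det_four_block_mat_lower_left_zero_col[of _ _ n] det_single)
  ultimately show ?thesis
    by simp
qed

lemma sum_fdiff:
  assumes "a \<le> b"
  shows "(\<Sum>k = a..<b. fdiff u k) = u b - u a"
  unfolding fdiff_def using assms by (rule sum_Suc_diff')

text \<open>After row subtraction, each entry is a sum of first differences over the gap between two
  adjacent points. Multilinearity gives smaller determinants of the same kind, for the differenced
  functions at one point per gap.\<close>

lemma minor_collocation_nonneg:
  assumes "\<And>i k. i < m \<Longrightarrow> (fdiff ^^ i) (g i) k = c i"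
    and "\<And>i. i < m \<Longrightarrow> c i \<ge> 0"
    and "seq_convex m (g m)"
    and "strict_mono_on {..<Suc m} t"
  shows "minor (\<lambda>j i. g i j) (Suc m) t (\<lambda>i. i) \<ge> 0"
  using assms
proof (induction m arbitrary: g c t)
  case 0
  then show ?case
    by (simp add: minor_eq_sum_permutations seq_convex_def)
next
  case (Suc m)
  let ?S = "\<lambda>l. {t l..<t (Suc l)}"
  have less: "t l < t (Suc l)" if "l < Suc m" for l
    using Suc.prems(4) that by (auto simp: strict_mono_on_def)
  have "minor (\<lambda>j i. g i j) (Suc (Suc m)) t (\<lambda>i. i) =
      c 0 * det (mat (Suc m) (Suc m) (\<lambda>(l, i). g (Suc i) (t (Suc l)) - g (Suc i) (t l)))"
    unfolding minor_def by (rule det_const_first_column) (use Suc.prems(1)[of 0] in simp)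
  also have "mat (Suc m) (Suc m) (\<lambda>(l, i). g (Suc i) (t (Suc l)) - g (Suc i) (t l)) =
      mat (Suc m) (Suc m) (\<lambda>(l, i). \<Sum>k\<in>?S l. fdiff (g (Suc i)) k)"
    by (rule eq_matI) (auto simp: sum_fdiff less_imp_le less)
  also have "det \<dots> = (\<Sum>\<tau>\<in>PiE {0..<Suc m} ?S.
      minor (\<lambda>j i. fdiff (g (Suc i)) j) (Suc m) \<tau> (\<lambda>i. i))"
    unfolding minor_def by (rule det_sum_rows) simp
  also have "c 0 * \<dots> \<ge> 0"
  proof (intro mult_nonneg_nonneg sum_nonneg)
    fix \<tau> assume \<tau>: "\<tau> \<in> PiE {0..<Suc m} ?S"
    \<comment> \<open>The half-open gaps are disjoint and ordered from left to right, so the chosen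
      points increase.\<close>
    have "\<tau> l < \<tau> l'" if "l < l'" "l' < Suc m" for l l'
    proof -
      have "\<tau> l < t (Suc l)"
        using \<tau> that by (auto simp: PiE_def Pi_def)
      also have "t (Suc l) \<le> t l'"
        using Suc.prems(4) that by (cases "Suc l = l'") (auto simp: strict_mono_on_def less_imp_le)
      also have "t l' \<le> \<tau> l'"
        using \<tau> that by (auto simp: PiE_def Pi_def)
      finally show ?thesis .
    qed
    then have "strict_mono_on {..<Suc m} \<tau>"
      by (auto simp: strict_mono_on_def)
    moreover have "(fdiff ^^ i) (fdiff (g (Suc i))) k = c (Suc i)" if "i < m" for i k
      using Suc.prems(1)[of "Suc i" k] that by (simp add: funpow_swap1)
    moreover have "seq_convex m (fdiff (g (Suc m)))"
      using Suc.prems(3) by (simp add: seq_convex_def funpow_swap1)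
    ultimately show "minor (\<lambda>j i. fdiff (g (Suc i)) j) (Suc m) \<tau> (\<lambda>i. i) \<ge> 0"
      using Suc.prems(2) by (intro Suc.IH[where c = "\<lambda>i. c (Suc i)"]) auto
  qed (use Suc.prems(2) in simp)
  finally show ?case .
qed

text \<open>With unit spacing each gap contains a single point, so the same recursion yields an
  identity. It holds for constants \<open>c i\<close> of any sign, as is required for the images
  under the kernel.\<close>

lemma minor_collocation_consecutive:
  assumes "\<And>i k. i < m \<Longrightarrow> (fdiff ^^ i) (g i) k = c i"
  shows "minor (\<lambda>j i. g i j) (Suc m) (\<lambda>l. n + l) (\<lambda>i. i) = (\<Prod>i<m. c i) * (fdiff ^^ m) (g m) n"
  using assms
proof (induction m arbitrary: g c)
  case 0
  then show ?case
    by (simp add: minor_eq_sum_permutations)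
next
  case (Suc m)
  have "minor (\<lambda>j i. g i j) (Suc (Suc m)) (\<lambda>l. n + l) (\<lambda>i. i) =
      c 0 * det (mat (Suc m) (Suc m) (\<lambda>(l, i). g (Suc i) (n + Suc l) - g (Suc i) (n + l)))"
    unfolding minor_def by (rule det_const_first_column) (use Suc.prems[of 0] in simp)
  also have "\<dots> = c 0 * minor (\<lambda>j i. fdiff (g (Suc i)) j) (Suc m) (\<lambda>l. n + l) (\<lambda>i. i)"
    by (simp add: minor_def fdiff_def)
  also have "\<dots> = c 0 * ((\<Prod>i<m. c (Suc i)) * (fdiff ^^ m) (fdiff (g (Suc m))) n)"
  proof (subst Suc.IH[where c = "\<lambda>i. c (Suc i)"])
    show "(fdiff ^^ i) (fdiff (g (Suc i))) k = c (Suc i)" if "i < m" for i k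
      using Suc.prems[of "Suc i" k] that by (simp add: funpow_swap1)
  qed simp
  also have "\<dots> = (\<Prod>i<Suc m. c i) * (fdiff ^^ Suc m) (g (Suc m)) n"
    by (simp add: prod.lessThan_Suc_shift funpow_swap1 del: prod.lessThan_Suc)
  finally show ?case .
qed


section \<open>Differences of polynomials\<close>

lemma funpow_fdiff_add: "(fdiff ^^ m) (\<lambda>k. u k + v k) = (\<lambda>k. (fdiff ^^ m) u k + (fdiff ^^ m) v k)"
  by (induction m) (auto simp: fdiff_def)

lemma funpow_fdiff_const: "(fdiff ^^ Suc m) (\<lambda>_. a) = (\<lambda>_. 0)"
  by (induction m) (auto simp: fdiff_def)

text \<open>The discrete Leibniz rule has only two terms here, since the second difference of
  \<open>k\<close> vanishes.\<close>

lemma funpow_fdiff_times_index: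
  "(fdiff ^^ Suc m) (\<lambda>k. real k * u k) =
     (\<lambda>k. real (k + Suc m) * (fdiff ^^ Suc m) u k + real (Suc m) * (fdiff ^^ m) u k)"
proof (induction m)
  case 0
  show ?case
    by (auto simp: fdiff_def algebra_simps)
next
  case (Suc m)
  define v where "v = (fdiff ^^ m) u"
  have "(fdiff ^^ Suc (Suc m)) (\<lambda>k. real k * u k) = fdiff ((fdiff ^^ Suc m) (\<lambda>k. real k * u k))"
    by simp
  also have "\<dots> = fdiff (\<lambda>k. real (k + Suc m) * fdiff v k + real (Suc m) * v k)"
    unfolding Suc.IH v_def by simp
  also have "\<dots> = (\<lambda>k. real (k + Suc (Suc m)) * fdiff (fdiff v) k + real (Suc (Suc m)) * fdiff v k)"
    by (auto simp: fdiff_def algebra_simps)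
  finally show ?case
    by (simp add: v_def)
qed

text \<open>Write \<open>p\<close> as \<open>a + x * q\<close>. The constant \<open>a\<close> is
  annihilated, and in the Leibniz rule for \<open>x * q\<close> only the lower-order term remains,
  because the \<open>m\<close>-th difference of \<open>q\<close> is already constant.\<close>

lemma funpow_fdiff_poly_seq:
  assumes "degree p \<le> m"
  shows "(fdiff ^^ m) (poly_seq p) = (\<lambda>_. fact m * coeff p m)"
  using assms
proof (induction m arbitrary: p)
  case 0
  then obtain a where "p = [:a:]"
    using degree_eq_zeroE by blast
  then show ?case
    by (auto simp: poly_seq_def)
next
  case (Suc m)
  obtain a q where p: "p = pCons a q"
    by (cases p)
  have "degree q \<le> m"
    using Suc.prems p by (cases "q = 0") auto
  note IH = Suc.IH[OF this]
  have "(fdiff ^^ Suc m) (poly_seq p) = (fdiff ^^ Suc m) (\<lambda>k. a + real k * poly_seq q k)"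
    by (simp add: poly_seq_def p)
  also have "\<dots> = (\<lambda>k. real (k + Suc m) * fdiff ((fdiff ^^ m) (poly_seq q)) k +
      real (Suc m) * (fdiff ^^ m) (poly_seq q) k)"
    unfolding funpow_fdiff_add funpow_fdiff_const funpow_fdiff_times_index by simp
  also have "\<dots> = (\<lambda>_. fact (Suc m) * coeff p (Suc m))"
    unfolding IH by (auto simp: fdiff_def p algebra_simps)
  finally show ?case .
qed


section \<open>Kernels preserving polynomial degrees\<close>

lemma kernel_uminus:
  assumes "kernel_defined K u"
  shows "kernel_defined (\<lambda>n j. - K n j) u" "kernel_op (\<lambda>n j. - K n j) u = (\<lambda>n. - kernel_op K u n)"
  using assms by (auto simp: kernel_defined_def kernel_op_def summable_minus_iff suminf_minus)

lemma sequence_uminus: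
  assumes "kernel_defined K u"
  shows "kernel_defined K (\<lambda>j. - u j)" "kernel_op K (\<lambda>j. - u j) = (\<lambda>n. - kernel_op K u n)"
  using assms by (auto simp: kernel_defined_def kernel_op_def summable_minus_iff suminf_minus)

lemma kernel_add_scaled:
  assumes "kernel_defined K u" "kernel_defined K v"
  shows "kernel_defined K (\<lambda>j. u j + a * v j)"
    and "kernel_op K (\<lambda>j. u j + a * v j) n = kernel_op K u n + a * kernel_op K v n"
proof -
  have u: "summable (\<lambda>j. K n j * u j)" and v: "summable (\<lambda>j. a * (K n j * v j))" for n
    using assms by (auto simp: kernel_defined_def intro!: summable_mult)
  show "kernel_defined K (\<lambda>j. u j + a * v j)"
    using summable_add[OF u v] by (simp add: kernel_defined_def algebra_simps)
  show "kernel_op K (\<lambda>j. u j + a * v j) n = kernel_op K u n + a * kernel_op K v n"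
    using suminf_add[OF u v] assms(2)
    by (simp add: kernel_op_def kernel_defined_def suminf_mult algebra_simps)
qed

lemma maps_degree_uminus:
  assumes "maps_degree K k"
  shows "maps_degree (\<lambda>n j. - K n j) k"
  unfolding maps_degree_def
proof (intro allI impI conjI)
  fix p :: "real poly" assume "degree p = k"
  then obtain q where def: "kernel_defined K (poly_seq p)" and "degree q = k"
    and "kernel_op K (poly_seq p) = poly_seq q"
    using assms unfolding maps_degree_def by blast
  then show "\<exists>q. degree q = k \<and> kernel_op (\<lambda>n j. - K n j) (poly_seq p) = poly_seq q"
    by (intro exI[of _ "- q"]) (simp add: kernel_uminus poly_seq_def)
  from def show "kernel_defined (\<lambda>n j. - K n j) (poly_seq p)"
    by (rule kernel_uminus)
qed

text \<open>The constant is \<open>k!\<close> times the leading coefficient of the image;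
  \<open>k \<ge> 1\<close> rules out the zero polynomial, whose degree is 0 by convention.\<close>

lemma maps_degree_leading_difference:
  assumes "maps_degree K k" "degree p = k" "k \<ge> 1"
  obtains c where "kernel_defined K (poly_seq p)" "c \<noteq> 0"
    "(fdiff ^^ k) (kernel_op K (poly_seq p)) = (\<lambda>_. c)"
proof -
  obtain q where "kernel_defined K (poly_seq p)" and q: "degree q = k"
    and "kernel_op K (poly_seq p) = poly_seq q"
    using assms unfolding maps_degree_def by blast
  moreover have "fact k * coeff q k \<noteq> 0"
    using q assms(3) leading_coeff_0_iff[of q] by auto
  ultimately show thesis
    using funpow_fdiff_poly_seq[of q k] that[of "fact k * coeff q k"] by simp
qed

text \<open>
  If the image of the constant sequence \<open>1\<close> had slope \<open>\<alpha> \<noteq> 0\<close>, and that of \<open>j\<close> slope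
  \<open>a\<close>, then the image of \<open>j - a / \<alpha>\<close> would be constant.
\<close>

lemma maps_degree_1_constant:
  assumes "maps_degree K 1"
  obtains c where "kernel_defined K (\<lambda>_. 1)" "kernel_op K (\<lambda>_. 1) = (\<lambda>_. c)"
proof -
  let ?x = "poly_seq [:0, 1:]"
  have slope: "\<exists>d. kernel_defined K (poly_seq [:b, 1:]) \<and> d \<noteq> 0 \<and>
      (\<forall>n. kernel_op K (poly_seq [:b, 1:]) (Suc n) - kernel_op K (poly_seq [:b, 1:]) n = d)" for b
    by (rule maps_degree_leading_difference[OF assms, of "[:b, 1:]"])
       (auto simp: fdiff_def fun_eq_iff)
  obtain a where x: "kernel_defined K ?x" and a: "a \<noteq> 0"
    and x_slope: "\<And>n. kernel_op K ?x (Suc n) - kernel_op K ?x n = a"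
    using slope[of 0] by blast
  obtain b where x1: "kernel_defined K (poly_seq [:1, 1:])"
    and x1_slope: "\<And>n. kernel_op K (poly_seq [:1, 1:]) (Suc n) - kernel_op K (poly_seq [:1, 1:]) n = b"
    using slope[of 1] by blast
  \<comment> \<open>The assumption concerns degree 1 only, so the constant 1 is reached as the
    difference of \<open>x + 1\<close> and \<open>x\<close>.\<close>
  have one: "(\<lambda>_. 1) = (\<lambda>j. poly_seq [:1, 1:] j + (- 1) * ?x j)"
    by (auto simp: poly_seq_def)
  have def1: "kernel_defined K (\<lambda>_. 1)"
    unfolding one by (rule kernel_add_scaled[OF x1 x])
  have slope1: "kernel_op K (\<lambda>_. 1) (Suc n) - kernel_op K (\<lambda>_. 1) n = b - a" for n
    using x_slope[of n] x1_slope[of n] unfolding one kernel_add_scaled[OF x1 x] by simp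
  have "b = a"
  proof (rule ccontr)
    assume "b \<noteq> a"
    define s where "s = - a / (b - a)"
    obtain d where "d \<noteq> 0"
      and d: "\<And>n. kernel_op K (poly_seq [:s, 1:]) (Suc n) - kernel_op K (poly_seq [:s, 1:]) n = d"
      using slope[of s] by blast
    have "poly_seq [:s, 1:] = (\<lambda>j. ?x j + s * 1)"
      by (auto simp: poly_seq_def)
    then have "d = a + s * (b - a)"
      using d[of 0] x_slope[of 0]
      by (simp only: kernel_add_scaled(2)[OF x def1] slope1[of 0, symmetric])
         (simp add: algebra_simps)
    with \<open>d \<noteq> 0\<close> \<open>b \<noteq> a\<close> show False
      by (simp add: s_def)
  qed
  then have "kernel_op K (\<lambda>_. 1) n = kernel_op K (\<lambda>_. 1) 0" for n
    by (induction n) (use slope1 in auto)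
  with def1 show thesis
    by (intro that) auto
qed

text \<open>Positive exponents are covered by degree preservation. For exponent 0 the image is a
  constant; were it zero, the nonnegative kernel would vanish entirely and could not map
  \<open>j\<close> to a polynomial of degree 1.\<close>

lemma monomial_images:
  assumes "m > 1" and deg: "\<And>k. k \<in> {1..m - 1} \<Longrightarrow> maps_degree K k"
    and nonneg: "\<And>n j. K n j \<ge> 0"
  obtains c where
    "\<And>i. i < m \<Longrightarrow> kernel_defined K (poly_seq (monom 1 i))"
    "\<And>i k. i < m \<Longrightarrow> (fdiff ^^ i) (kernel_op K (poly_seq (monom 1 i))) k = c i"
    "\<And>i. i < m \<Longrightarrow> c i \<noteq> 0"
proof -
  have deg1: "maps_degree K 1"
    using assms(1) deg[of 1] by simp
  have "\<exists>c. kernel_defined K (poly_seq (monom 1 i)) \<and> c \<noteq> 0 \<and>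
      (fdiff ^^ i) (kernel_op K (poly_seq (monom 1 i))) = (\<lambda>_. c)" if "i < m" for i
  proof (cases "i = 0")
    case False
    show ?thesis
      by (rule maps_degree_leading_difference[of K i "monom 1 i"])
         (use False that in \<open>auto simp: degree_monom_eq intro!: deg\<close>)
  next
    case True
    have one: "poly_seq (monom 1 0) = (\<lambda>_. 1)"
      by (auto simp: poly_seq_def monom_0)
    obtain c where def1: "kernel_defined K (\<lambda>_. 1)" and c: "kernel_op K (\<lambda>_. 1) = (\<lambda>_. c)"
      using maps_degree_1_constant[OF deg1] .
    have "c \<noteq> 0"
    proof
      assume "c = 0"
      have zero: "K n j = 0" for n j
        using def1 fun_cong[OF c, of n] nonneg \<open>c = 0\<close> suminf_eq_zero_iff[of "K n"]
        by (auto simp: kernel_defined_def kernel_op_def)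
      obtain d where "d \<noteq> 0" "(fdiff ^^ 1) (kernel_op K (poly_seq [:0, 1:])) = (\<lambda>_. d)"
        by (rule maps_degree_leading_difference[OF deg1, of "[:0, 1:]"]) auto
      then show False
        by (simp add: kernel_op_def zero fdiff_def fun_eq_iff)
    qed
    with def1 c show ?thesis
      using True one by auto
  qed
  then obtain c where "\<And>i. i < m \<Longrightarrow> kernel_defined K (poly_seq (monom 1 i)) \<and> c i \<noteq> 0 \<and>
      (fdiff ^^ i) (kernel_op K (poly_seq (monom 1 i))) = (\<lambda>_. c i)"
    by metis
  then show thesis
    by (intro that[of c]) auto
qed

section \<open>Signs of the differences of images\<close>

text \<open>The order \<open>k\<close> is kept free: besides the final application to
  \<open>u\<close> at order \<open>m\<close>, the bound is applied to monomials to find the sign of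
  products of the \<open>c i\<close>.\<close>

lemma image_difference_sign:
  assumes minors: "\<And>\<rho> \<kappa>. strict_mono_on {..<Suc k} \<rho> \<Longrightarrow> strict_mono_on {..<Suc k} \<kappa> \<Longrightarrow>
      \<epsilon> * minor K (Suc k) \<rho> \<kappa> \<ge> 0"
    and def: "\<And>i. i < k \<Longrightarrow> kernel_defined K (poly_seq (monom 1 i))"
    and c: "\<And>i n. i < k \<Longrightarrow> (fdiff ^^ i) (kernel_op K (poly_seq (monom 1 i))) n = c i"
    and u: "kernel_defined K u" "seq_convex k u"
  shows "\<epsilon> * ((\<Prod>i<k. c i) * (fdiff ^^ k) (kernel_op K u) n) \<ge> 0"
proof -
  define g where "g = (\<lambda>i. if i = k then u else poly_seq (monom 1 i))"
  have "\<epsilon> * minor (\<lambda>j i. kernel_op K (g i) j) (Suc k) (\<lambda>l. n + l) (\<lambda>i. i) \<ge> 0"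
  proof (rule minor_kernel_op_nonneg)
    show "kernel_defined K (g i)" if "i < Suc k" for i
      using that def u by (auto simp: g_def)
  next
    fix \<kappa> :: "nat \<Rightarrow> nat" assume \<kappa>: "strict_mono_on {..<Suc k} \<kappa>"
    have "minor (\<lambda>j i. g i j) (Suc k) \<kappa> (\<lambda>i. i) \<ge> 0"
      \<comment> \<open>The \<open>i\<close>-th difference of \<open>j^i\<close> is
        \<open>i!\<close>.\<close>
      by (rule minor_collocation_nonneg[where c = fact])
         (use \<kappa> u in \<open>auto simp: g_def funpow_fdiff_poly_seq degree_monom_le\<close>)
    then show "\<epsilon> * (minor K (Suc k) (\<lambda>l. n + l) \<kappa> * minor (\<lambda>j i. g i j) (Suc k) \<kappa> (\<lambda>i. i)) \<ge> 0"
      using minors[OF _ \<kappa>, of "\<lambda>l. n + l"]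
      by (simp add: strict_mono_on_def flip: mult.assoc)
  qed
  also have "minor (\<lambda>j i. kernel_op K (g i) j) (Suc k) (\<lambda>l. n + l) (\<lambda>i. i) =
      (\<Prod>i<k. c i) * (fdiff ^^ k) (kernel_op K (g k)) n"
    by (rule minor_collocation_consecutive) (use c in \<open>auto simp: g_def\<close>)
  finally show ?thesis
    by (simp add: g_def)
qed

lemma totally_positive_preserves_convexity:
  assumes "m > 1" and deg: "\<And>k. k \<in> {1..m - 1} \<Longrightarrow> maps_degree K k"
    and tp: "totally_positive (m + 1) K"
  shows "preserves_convexity m K"
  unfolding preserves_convexity_def
proof (intro allI impI)
  fix u assume u: "kernel_defined K u" "seq_convex m u"
  have minors: "1 * minor K (Suc k) \<rho> \<kappa> \<ge> 0"
    if "k \<le> m" "strict_mono_on {..<Suc k} \<rho>" "strict_mono_on {..<Suc k} \<kappa>" for k \<rho> \<kappa>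
    using tp that by (auto simp: totally_positive_def)
  have "K n j \<ge> 0" for n j
    using minors[of 0 "\<lambda>_. n" "\<lambda>_. j", OF _ strict_mono_onI strict_mono_onI]
    by (simp add: minor_eq_sum_permutations)
  then obtain c where def: "\<And>i. i < m \<Longrightarrow> kernel_defined K (poly_seq (monom 1 i))"
    and c: "\<And>i k. i < m \<Longrightarrow> (fdiff ^^ i) (kernel_op K (poly_seq (monom 1 i))) k = c i"
    and nz: "\<And>i. i < m \<Longrightarrow> c i \<noteq> 0"
    using monomial_images[OF assms(1) deg] by blast
  \<comment> \<open>The sequence \<open>j^(m-1)\<close> is \<open>(m-1)\<close>-convex and its image
    has \<open>(m-1)\<close>-th difference \<open>c (m - 1)\<close>, so the bound at order
    \<open>m - 1\<close> contains exactly the full product.\<close>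
  have "(\<Prod>i<m. c i) \<ge> 0"
  proof -
    obtain r where r: "m = Suc r"
      using assms(1) by (cases m) auto
    have "seq_convex r (poly_seq (monom 1 r))"
      by (simp add: seq_convex_def funpow_fdiff_poly_seq degree_monom_le)
    then have "1 * ((\<Prod>i<r. c i) * (fdiff ^^ r) (kernel_op K (poly_seq (monom 1 r))) 0) \<ge> 0"
      using def c r by (intro image_difference_sign minors) auto
    then show ?thesis
      using c r by simp
  qed
  then have "(\<Prod>i<m. c i) > 0"
    using nz by (simp add: order.order_iff_strict)
  moreover have "1 * ((\<Prod>i<m. c i) * (fdiff ^^ m) (kernel_op K u) n) \<ge> 0" for n
    using def c u by (intro image_difference_sign minors) auto
  ultimately show "seq_convex m (kernel_op K u)"
    unfolding seq_convex_def by (simp add: zero_le_mult_iff not_le[symmetric])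
qed

text \<open>
  A nonnegative kernel with nonpositive minors of order 2 would map the sequence \<open>j\<close> to a
  nonnegative sequence with constant negative slope.
\<close>

lemma not_totally_negative_uminus:
  assumes "maps_degree K 1" "r \<ge> 2"
  shows "\<not> totally_negative r (\<lambda>n j. - K n j)"
proof
  assume tn: "totally_negative r (\<lambda>n j. - K n j)"
  then have minors: "minor (\<lambda>n j. - K n j) (Suc k) \<rho> \<kappa> \<le> 0"
    if "k \<le> 1" "strict_mono_on {..<Suc k} \<rho>" "strict_mono_on {..<Suc k} \<kappa>" for k \<rho> \<kappa>
    using that assms(2) by (auto simp: totally_negative_def)
  have nonneg: "K n j \<ge> 0" for n j
    using minors[of 0 "\<lambda>_. n" "\<lambda>_. j", OF _ strict_mono_onI strict_mono_onI]
    by (simp add: minor_eq_sum_permutations)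
  let ?x = "poly_seq (monom 1 (Suc 0))"
  obtain c where def: "\<And>i. i < 2 \<Longrightarrow> kernel_defined K (poly_seq (monom 1 i))"
    and c: "\<And>i k. i < 2 \<Longrightarrow> (fdiff ^^ i) (kernel_op K (poly_seq (monom 1 i))) k = c i"
    and nz: "\<And>i. i < 2 \<Longrightarrow> c i \<noteq> 0"
    using monomial_images[of 2 K] assms(1) nonneg by auto
  have "- 1 * ((\<Prod>i<1. c i) * (fdiff ^^ 1) (kernel_op K ?x) 0) \<ge> 0"
  proof (rule image_difference_sign)
    \<comment> \<open>Minors of order 2 do not change when all entries are negated.\<close>
    show "- 1 * minor K (Suc 1) \<rho> \<kappa> \<ge> 0"
      if "strict_mono_on {..<Suc 1} \<rho>" "strict_mono_on {..<Suc 1} \<kappa>" for \<rho> \<kappa>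
      using minors[OF _ that] by (simp add: minor_uminus)
    show "seq_convex 1 ?x"
      unfolding seq_convex_def by (subst funpow_fdiff_poly_seq) (auto simp: degree_monom_le)
  qed (use def[of 0] def[of 1] c[of 0] in auto)
  then have "c 0 * c 1 \<le> 0"
    using c[of 1] by simp
  moreover have "c 0 \<ge> 0"
    using c[of 0 0] nonneg def[of 0] suminf_nonneg[of "K 0"]
    by (auto simp: kernel_op_def kernel_defined_def poly_seq_def monom_0)
  ultimately have "c 1 < 0"
    using nz[of 0] nz[of 1] by (auto simp: mult_le_0_iff)
  have slope: "kernel_op K ?x n = kernel_op K ?x 0 + real n * c 1" for n
  proof (induction n)
    case (Suc n)
    then show ?case
      using c[of 1 n] by (simp add: fdiff_def algebra_simps)
  qed simp
  have image_nonneg: "kernel_op K ?x n \<ge> 0" for n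
    using nonneg def[of 1]
    by (auto simp: kernel_op_def kernel_defined_def poly_seq_def poly_monom intro!: suminf_nonneg)
  obtain n where "kernel_op K ?x 0 < real n * (- c 1)"
    using \<open>c 1 < 0\<close> ex_less_of_nat_mult[of "- c 1"] by auto
  with slope[of n] image_nonneg[of n] show False
    by simp
qed

section \<open>Symmetries under negation of the sequence and of the kernel\<close>

lemma preserves_concavity_if_preserves_convexity:
  assumes "preserves_convexity m K"
  shows "preserves_concavity m K"
  unfolding preserves_concavity_def seq_concave_def
proof (intro allI impI)
  fix u assume u: "kernel_defined K u" "seq_convex m (\<lambda>k. - u k)"
  show "seq_convex m (\<lambda>n. - kernel_op K u n)"
    using assms[unfolded preserves_convexity_def, rule_format, OF sequence_uminus(1)[OF u(1)] u(2)]
    by (simp only: sequence_uminus(2)[OF u(1)])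
qed

text \<open>Negating the kernel negates the image, which exchanges convexity and concavity of the
  output; the second claim also negates the input.\<close>

lemma preserves_uminus_imp_reverses:
  assumes "preserves_convexity m (\<lambda>n j. - K n j)"
  shows "reverses_convexity m K" "reverses_concavity m K"
proof -
  have *: "seq_convex m (\<lambda>n. - kernel_op K u n)" if "kernel_defined K u" "seq_convex m u" for u
    using assms that kernel_uminus[OF that(1)] unfolding preserves_convexity_def by metis
  then show "reverses_convexity m K"
    by (simp add: reverses_convexity_def seq_concave_def)
  show "reverses_concavity m K"
    unfolding reverses_concavity_def seq_concave_def
  proof (intro allI impI)
    fix u assume u: "kernel_defined K u" "seq_convex m (\<lambda>k. - u k)"
    show "seq_convex m (kernel_op K u)"
      using *[OF sequence_uminus(1)[OF u(1)] u(2)] sequence_uminus(2)[OF u(1)] by simp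
  qed
qed

theorem mainTheorem2:
  fixes m :: nat and K :: "nat \<Rightarrow> nat \<Rightarrow> real"
  assumes "m > 1"
    and "\<And>k. k \<in> {1..m - 1} \<Longrightarrow> maps_degree K k"
  shows "(totally_positive (m + 1) K \<or> totally_negative (m + 1) (\<lambda>n j. - K n j) \<longrightarrow>
            preserves_convexity m K \<and> preserves_concavity m K) \<and>
         (totally_positive (m + 1) (\<lambda>n j. - K n j) \<or> totally_negative (m + 1) K \<longrightarrow>
            reverses_convexity m K \<and> reverses_concavity m K)"
proof -
  \<comment> \<open>Stated for a general kernel in order to be used for both \<open>K\<close> and
    \<open>-K\<close>; in the latter case the double negation returns \<open>K\<close> in the
    totally negative alternative.\<close>
  have preserve: "preserves_convexity m M"
    if deg: "\<And>k. k \<in> {1..m - 1} \<Longrightarrow> maps_degree M k"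
      and "totally_positive (m + 1) M \<or> totally_negative (m + 1) (\<lambda>n j. - M n j)" for M
  proof -
    have "\<not> totally_negative (m + 1) (\<lambda>n j. - M n j)"
      using assms(1) deg[of 1] by (intro not_totally_negative_uminus) auto
    with that show ?thesis
      using totally_positive_preserves_convexity[OF assms(1) deg] by blast
  qed
  show ?thesis
    using preserve[of K] preserve[of "\<lambda>n j. - K n j"] assms(2) maps_degree_uminus
      preserves_concavity_if_preserves_convexity preserves_uminus_imp_reverses[of m K]
    by auto
qed

end
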